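(* Let $k$ be a commutative ring with identity, and let $I$ and $J$ be ideals of a pre-Lie $k$-algebra $A$. Then $$[I,J]=IJ+\sum_{n\ge 0}S_n,$$ where $S_n=((\dots(((JI)A)A)\dots)A)A$, with $n$ factors equal to $A$ on the right of the factor $JI$ (that is, $S_0=JI$ and $S_{n+1}=S_nA$ for every $n\ge 0$).
   Context: A $k$-algebra is a $k$-module with a $k$-bilinear multiplication (not necessarily associative). A pre-Lie $k$-algebra is a $k$-algebra $A$ with $(xy)z-x(yz)=(yx)z-y(xz)$ for all $x,y,z\in A$. An ideal of $A$ is a $k$-submodule $N$ with $xn\in N$ and $nx\in N$ for all $x\in A$, $n\in N$. For $k$-submodules $X,Y$ of $A$, $XY$ denotes the $k$-submodule of all finite sums of products $xy$ with $x\in X$, $y\in Y$. The commutator $[I,J]$ of two ideals $I,J$ of $A$ is the ideal of $A$ generated by $\{\,ij,\ ji\mid i\in I,\ j\in J\,\}$, that is, the smallest ideal of $A$ containing this set. *)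

theory Defs
  imports "HOL-Algebra.Module" "HOL-Algebra.AbelCoset"
begin

text \<open>The multiplication of the algebra is the \<open>mult\<close> field of the \<open>module\<close> record. No unit is
  assumed, so the \<open>one\<close> field is junk. The library locale \<open>algebra\<close> is not suitable, since it
  requires a commutative associative unital multiplication. The base ring is an arbitrary \<open>cring\<close>,
  the zero ring included.\<close>

locale nonassoc_algebra = module k A
  for k :: "('k, 'r) ring_scheme" (structure) and A :: "('k, 'a, 'm) module_scheme" (structure) +
  assumes mult_closed:
      "\<lbrakk>x \<in> carrier A; y \<in> carrier A\<rbrakk> \<Longrightarrow> x \<otimes>\<^bsub>A\<^esub> y \<in> carrier A"
    and mult_add_left:
      "\<lbrakk>x \<in> carrier A; y \<in> carrier A; z \<in> carrier A\<rbrakk> \<Longrightarrow>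
       (x \<oplus>\<^bsub>A\<^esub> y) \<otimes>\<^bsub>A\<^esub> z = x \<otimes>\<^bsub>A\<^esub> z \<oplus>\<^bsub>A\<^esub> y \<otimes>\<^bsub>A\<^esub> z"
    and mult_add_right:
      "\<lbrakk>x \<in> carrier A; y \<in> carrier A; z \<in> carrier A\<rbrakk> \<Longrightarrow>
       x \<otimes>\<^bsub>A\<^esub> (y \<oplus>\<^bsub>A\<^esub> z) = x \<otimes>\<^bsub>A\<^esub> y \<oplus>\<^bsub>A\<^esub> x \<otimes>\<^bsub>A\<^esub> z"
    and mult_smult_left:
      "\<lbrakk>c \<in> carrier k; x \<in> carrier A; y \<in> carrier A\<rbrakk> \<Longrightarrow>
       (c \<odot>\<^bsub>A\<^esub> x) \<otimes>\<^bsub>A\<^esub> y = c \<odot>\<^bsub>A\<^esub> (x \<otimes>\<^bsub>A\<^esub> y)"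
    and mult_smult_right:
      "\<lbrakk>c \<in> carrier k; x \<in> carrier A; y \<in> carrier A\<rbrakk> \<Longrightarrow>
       x \<otimes>\<^bsub>A\<^esub> (c \<odot>\<^bsub>A\<^esub> y) = c \<odot>\<^bsub>A\<^esub> (x \<otimes>\<^bsub>A\<^esub> y)"

locale pre_lie_algebra = nonassoc_algebra +
  assumes pre_lie:
    "\<lbrakk>x \<in> carrier A; y \<in> carrier A; z \<in> carrier A\<rbrakk> \<Longrightarrow>
     (x \<otimes>\<^bsub>A\<^esub> y) \<otimes>\<^bsub>A\<^esub> z \<ominus>\<^bsub>A\<^esub> x \<otimes>\<^bsub>A\<^esub> (y \<otimes>\<^bsub>A\<^esub> z) =
     (y \<otimes>\<^bsub>A\<^esub> x) \<otimes>\<^bsub>A\<^esub> z \<ominus>\<^bsub>A\<^esub> y \<otimes>\<^bsub>A\<^esub> (x \<otimes>\<^bsub>A\<^esub> z)"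

definition algebra_ideal ::
    "'a set \<Rightarrow> ('k, 'r) ring_scheme \<Rightarrow> ('k, 'a, 'm) module_scheme \<Rightarrow> bool" where
  "algebra_ideal N k A \<longleftrightarrow> submodule N k A \<and>
     (\<forall>x \<in> carrier A. \<forall>n \<in> N. x \<otimes>\<^bsub>A\<^esub> n \<in> N \<and> n \<otimes>\<^bsub>A\<^esub> x \<in> N)"

definition generated_algebra_ideal ::
    "('k, 'r) ring_scheme \<Rightarrow> ('k, 'a, 'm) module_scheme \<Rightarrow> 'a set \<Rightarrow> 'a set" where
  "generated_algebra_ideal k A X = \<Inter>{N. algebra_ideal N k A \<and> X \<subseteq> N}"

definition ideal_commutator ::
    "('k, 'r) ring_scheme \<Rightarrow> ('k, 'a, 'm) module_scheme \<Rightarrow> 'a set \<Rightarrow> 'a set \<Rightarrow> 'a set" where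
  "ideal_commutator k A I J =
     generated_algebra_ideal k A ({i \<otimes>\<^bsub>A\<^esub> j | i j. i \<in> I \<and> j \<in> J} \<union> {j \<otimes>\<^bsub>A\<^esub> i | i j. i \<in> I \<and> j \<in> J})"

definition submodule_prod ::
    "('k, 'a, 'm) module_scheme \<Rightarrow> 'a set \<Rightarrow> 'a set \<Rightarrow> 'a set" where
  "submodule_prod A X Y =
     {\<Oplus>\<^bsub>A\<^esub>i\<in>{..<n}. x i \<otimes>\<^bsub>A\<^esub> y i | (n::nat) x y. (\<forall>i<n. x i \<in> X) \<and> (\<forall>i<n. y i \<in> Y)}"

text \<open>The internal sum of a sequence of submodules: all finite sums of elements taken from distinct
  members of the sequence (omitted members contribute zero).\<close>

definition submodule_sum ::
    "('k, 'a, 'm) module_scheme \<Rightarrow> (nat \<Rightarrow> 'a set) \<Rightarrow> 'a set" where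
  "submodule_sum A S = {\<Oplus>\<^bsub>A\<^esub>n\<in>{..<m}. s n | m s. \<forall>n<m. s n \<in> S n}"

primrec right_mult_iter ::
    "('k, 'a, 'm) module_scheme \<Rightarrow> 'a set \<Rightarrow> nat \<Rightarrow> 'a set" where
  "right_mult_iter A X 0 = X"
| "right_mult_iter A X (Suc n) = submodule_prod A (right_mult_iter A X n) (carrier A)"

end

theory Submission
  imports Defs
begin

text \<open>The point is that the right-hand side is an ideal. The pre-Lie identity in the form
  \<open>x(yz) = (xy)z - (yx)z + y(xz)\<close> gives \<open>A(IJ) \<subseteq> IJ\<close> and \<open>A(JI) \<subseteq> JI\<close>, and, by induction on \<open>n\<close>,
  that \<open>A S\<^sub>n\<close> lies in the sum of the \<open>S\<^sub>m\<close>. In the form \<open>(ij)a = (ji)a - j(ia) + i(ja)\<close> it gives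
  \<open>(IJ)A \<subseteq> S\<^sub>1 + S\<^sub>0 + IJ\<close>.\<close>

section \<open>Cancellation of differences in an abelian group\<close>

context abelian_group
begin

text \<open>With \<open>u = (xy)z\<close> and \<open>v = x(yz)\<close>, this and the next lemma
  rearrange the pre-Lie identity.\<close>

lemma minus_minus_cancel:
  assumes "u \<in> carrier G" "v \<in> carrier G"
  shows "u \<ominus> (u \<ominus> v) = v"
  using assms by (simp add: a_minus_def minus_add a_assoc[symmetric] r_neg)

lemma minus_add_cancel:
  assumes "u \<in> carrier G" "v \<in> carrier G"
  shows "(u \<ominus> v) \<oplus> v = u"
  using assms by (simp add: a_minus_def a_assoc l_neg)

end

section \<open>Submodules, sums of two submodules and sums of sequences of submodules\<close>

context module
begin

lemma submoduleD:
  assumes "submodule N R M"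
  shows "N \<subseteq> carrier M" "\<zero>\<^bsub>M\<^esub> \<in> N"
    "\<And>u v. \<lbrakk>u \<in> N; v \<in> N\<rbrakk> \<Longrightarrow> u \<oplus>\<^bsub>M\<^esub> v \<in> N"
    "\<And>u v. \<lbrakk>u \<in> N; v \<in> N\<rbrakk> \<Longrightarrow> u \<ominus>\<^bsub>M\<^esub> v \<in> N"
    "\<And>c u. \<lbrakk>c \<in> carrier R; u \<in> N\<rbrakk> \<Longrightarrow> c \<odot>\<^bsub>M\<^esub> u \<in> N"
  \<comment> \<open>The zero vector is the unit of the additive monoid, of which a submodule is a
    subgroup; only this claim is left to \<open>metis\<close>.\<close>
  using submoduleE[OF assms]
  by (auto simp: a_minus_def)
    (metis submodule_def assms monoid.simps(2) subgroup.one_closed)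

text \<open>Closure under negation is multiplication by \<open>-1\<close>.\<close>

lemma submodule_by_closure:
  assumes "N \<subseteq> carrier M" "\<zero>\<^bsub>M\<^esub> \<in> N"
    and "\<And>u v. \<lbrakk>u \<in> N; v \<in> N\<rbrakk> \<Longrightarrow> u \<oplus>\<^bsub>M\<^esub> v \<in> N"
    and smult: "\<And>c u. \<lbrakk>c \<in> carrier R; u \<in> N\<rbrakk> \<Longrightarrow> c \<odot>\<^bsub>M\<^esub> u \<in> N"
  shows "submodule N R M"
proof (rule submoduleI)
  fix u assume "u \<in> N"
  then have "\<ominus>\<^bsub>M\<^esub> u = (\<ominus> \<one>) \<odot>\<^bsub>M\<^esub> u"
    using assms(1) smult_l_minus[of \<one> u] by auto
  then show "\<ominus>\<^bsub>M\<^esub> u \<in> N"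
    using smult[of "\<ominus> \<one>" u] \<open>u \<in> N\<close> by simp
qed (use assms in auto)

lemma finsum_mem_submodule:
  assumes N: "submodule N R M" and "\<And>i. i < (n::nat) \<Longrightarrow> f i \<in> N"
  shows "(\<Oplus>\<^bsub>M\<^esub>i\<in>{..<n}. f i) \<in> N"
  using assms(2)
proof (induction n)
  case 0
  then show ?case using submoduleD(2)[OF N] by simp
next
  case (Suc n)
  have "f i \<in> carrier M" if "i < Suc n" for i
    using Suc.prems[OF that] submoduleD(1)[OF N] by blast
  then show ?case
    using Suc submoduleD(3)[OF N] by (auto simp: lessThan_Suc Pi_def)
qed

lemma set_add_submodule:
  assumes N: "submodule N R M" and N': "submodule N' R M"
  shows "submodule (N <+>\<^bsub>M\<^esub> N') R M"
proof (rule submodule_by_closure)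
  note c = submoduleD(1)[OF N, THEN subsetD] submoduleD(1)[OF N', THEN subsetD]
  show "N <+>\<^bsub>M\<^esub> N' \<subseteq> carrier M"
    using c by (auto simp: set_add_def')
  show "\<zero>\<^bsub>M\<^esub> \<in> N <+>\<^bsub>M\<^esub> N'"
    using submoduleD(2)[OF N] submoduleD(2)[OF N'] by (force simp: set_add_def')
  fix u v assume "u \<in> N <+>\<^bsub>M\<^esub> N'" "v \<in> N <+>\<^bsub>M\<^esub> N'"
  then obtain a b a' b' where ab: "a \<in> N" "a' \<in> N" "b \<in> N'" "b' \<in> N'"
    "u = a \<oplus>\<^bsub>M\<^esub> b" "v = a' \<oplus>\<^bsub>M\<^esub> b'"
    by (auto simp: set_add_def')
  then have "u \<oplus>\<^bsub>M\<^esub> v = (a \<oplus>\<^bsub>M\<^esub> a') \<oplus>\<^bsub>M\<^esub> (b \<oplus>\<^bsub>M\<^esub> b')"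
    using c by (simp add: M.a_ac)
  then show "u \<oplus>\<^bsub>M\<^esub> v \<in> N <+>\<^bsub>M\<^esub> N'"
    using submoduleD(3)[OF N ab(1,2)] submoduleD(3)[OF N' ab(3,4)] unfolding set_add_def' by blast
next
  note c = submoduleD(1)[OF N, THEN subsetD] submoduleD(1)[OF N', THEN subsetD]
  fix r u assume r: "r \<in> carrier R" and "u \<in> N <+>\<^bsub>M\<^esub> N'"
  then obtain a b where ab: "a \<in> N" "b \<in> N'" "u = a \<oplus>\<^bsub>M\<^esub> b"
    by (auto simp: set_add_def')
  then have "r \<odot>\<^bsub>M\<^esub> u = r \<odot>\<^bsub>M\<^esub> a \<oplus>\<^bsub>M\<^esub> r \<odot>\<^bsub>M\<^esub> b"
    using r c by (simp add: smult_r_distr)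
  then show "r \<odot>\<^bsub>M\<^esub> u \<in> N <+>\<^bsub>M\<^esub> N'"
    using submoduleD(5)[OF N r ab(1)] submoduleD(5)[OF N' r ab(2)] unfolding set_add_def' by blast
qed

lemma set_add_superset:
  assumes N: "submodule N R M" and N': "submodule N' R M"
  shows "N \<subseteq> N <+>\<^bsub>M\<^esub> N'" "N' \<subseteq> N <+>\<^bsub>M\<^esub> N'"
proof -
  note z = submoduleD(2)[OF N] submoduleD(2)[OF N']
  note c = submoduleD(1)[OF N, THEN subsetD] submoduleD(1)[OF N', THEN subsetD]
  show "N \<subseteq> N <+>\<^bsub>M\<^esub> N'"
  proof
    fix u assume "u \<in> N"
    then have "u = u \<oplus>\<^bsub>M\<^esub> \<zero>\<^bsub>M\<^esub>" using c by simp
    then show "u \<in> N <+>\<^bsub>M\<^esub> N'" using \<open>u \<in> N\<close> z unfolding set_add_def' by blast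
  qed
  show "N' \<subseteq> N <+>\<^bsub>M\<^esub> N'"
  proof
    fix u assume "u \<in> N'"
    then have "u = \<zero>\<^bsub>M\<^esub> \<oplus>\<^bsub>M\<^esub> u" using c by simp
    then show "u \<in> N <+>\<^bsub>M\<^esub> N'" using \<open>u \<in> N'\<close> z unfolding set_add_def' by blast
  qed
qed

lemma set_add_subset:
  assumes "submodule L R M" "N \<subseteq> L" "N' \<subseteq> L"
  shows "N <+>\<^bsub>M\<^esub> N' \<subseteq> L"
  using assms(2,3) submoduleD(3)[OF assms(1)] by (auto simp: set_add_def')

text \<open>Padding with zeros changes neither the sum nor membership in the \<open>S n\<close>. It
  brings two elements of \<open>submodule_sum M S\<close> to a common length, so that they can be
  added term by term.\<close>

lemma submodule_sum_extend:
  assumes S: "\<And>n. submodule (S n) R M"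
    and "m \<le> (m'::nat)" "\<And>n. n < m \<Longrightarrow> s n \<in> S n"
  shows "\<exists>t. (\<forall>n<m'. t n \<in> S n) \<and> (\<Oplus>\<^bsub>M\<^esub>n\<in>{..<m'}. t n) = (\<Oplus>\<^bsub>M\<^esub>n\<in>{..<m}. s n)"
proof (intro exI[of _ "\<lambda>n. if n < m then s n else \<zero>\<^bsub>M\<^esub>"] conjI)
  show "\<forall>n<m'. (if n < m then s n else \<zero>\<^bsub>M\<^esub>) \<in> S n"
    using assms(3) submoduleD(2)[OF S] by auto
  have "s n \<in> carrier M" if "n < m" for n
    using assms(3)[OF that] submoduleD(1)[OF S] by blast
  then show "(\<Oplus>\<^bsub>M\<^esub>n\<in>{..<m'}. if n < m then s n else \<zero>\<^bsub>M\<^esub>) = (\<Oplus>\<^bsub>M\<^esub>n\<in>{..<m}. s n)"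
    using \<open>m \<le> m'\<close> by (intro M.add.finprod_mono_neutral_cong_right) auto
qed

lemma submodule_submodule_sum:
  assumes S: "\<And>n. submodule (S n) R M"
  shows "submodule (submodule_sum M S) R M"
proof (rule submodule_by_closure)
  note c = submoduleD(1)[OF S, THEN subsetD]
  show "submodule_sum M S \<subseteq> carrier M"
    using c by (auto simp: submodule_sum_def intro!: M.finsum_closed)
  show "\<zero>\<^bsub>M\<^esub> \<in> submodule_sum M S"
    \<comment> \<open>The empty sum, with \<open>m = 0\<close>.\<close>
    unfolding submodule_sum_def by (force intro: exI[of _ 0])
  fix u v assume "u \<in> submodule_sum M S" "v \<in> submodule_sum M S"
  then obtain m s m' s' where u: "u = (\<Oplus>\<^bsub>M\<^esub>n\<in>{..<m}. s n)" "\<And>n. n < m \<Longrightarrow> s n \<in> S n"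
    and v: "v = (\<Oplus>\<^bsub>M\<^esub>n\<in>{..<m'}. s' n)" "\<And>n. n < m' \<Longrightarrow> s' n \<in> S n"
    unfolding submodule_sum_def by blast
  obtain t where t_mem: "\<forall>n<max m m'. t n \<in> S n"
    and t_sum: "(\<Oplus>\<^bsub>M\<^esub>n\<in>{..<max m m'}. t n) = (\<Oplus>\<^bsub>M\<^esub>n\<in>{..<m}. s n)"
    using submodule_sum_extend[of S m "max m m'" s, OF S max.cobounded1 u(2)] by blast
  obtain t' where t'_mem: "\<forall>n<max m m'. t' n \<in> S n"
    and t'_sum: "(\<Oplus>\<^bsub>M\<^esub>n\<in>{..<max m m'}. t' n) = (\<Oplus>\<^bsub>M\<^esub>n\<in>{..<m'}. s' n)"
    using submodule_sum_extend[of S m' "max m m'" s', OF S max.cobounded2 v(2)] by blast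
  have "u \<oplus>\<^bsub>M\<^esub> v = (\<Oplus>\<^bsub>M\<^esub>n\<in>{..<max m m'}. t n \<oplus>\<^bsub>M\<^esub> t' n)"
    unfolding u(1) v(1) t_sum[symmetric] t'_sum[symmetric] using c t_mem t'_mem
    by (intro M.finsum_addf[symmetric]) auto
  moreover have "\<forall>n<max m m'. t n \<oplus>\<^bsub>M\<^esub> t' n \<in> S n"
    using submoduleD(3)[OF S] t_mem t'_mem by blast
  ultimately show "u \<oplus>\<^bsub>M\<^esub> v \<in> submodule_sum M S"
    unfolding submodule_sum_def by blast
next
  note c = submoduleD(1)[OF S, THEN subsetD]
  fix r u assume r: "r \<in> carrier R" and "u \<in> submodule_sum M S"
  then obtain m s where u: "u = (\<Oplus>\<^bsub>M\<^esub>n\<in>{..<m}. s n)" "\<And>n. n < m \<Longrightarrow> s n \<in> S n"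
    unfolding submodule_sum_def by blast
  have "r \<odot>\<^bsub>M\<^esub> u = (\<Oplus>\<^bsub>M\<^esub>n\<in>{..<m}. r \<odot>\<^bsub>M\<^esub> s n)"
    unfolding u(1) using r c[OF u(2)] by (intro finsum_smult_ldistr) auto
  then show "r \<odot>\<^bsub>M\<^esub> u \<in> submodule_sum M S"
    using submoduleD(5)[OF S r u(2)] unfolding submodule_sum_def by blast
qed

lemma submodule_sum_superset:
  assumes S: "\<And>n. submodule (S n) R M"
  shows "S n \<subseteq> submodule_sum M S"
proof
  fix u assume u: "u \<in> S n"
  \<comment> \<open>The sequence has \<open>u\<close> at position \<open>n\<close> and zero
    elsewhere. Its length is \<open>Suc n\<close>, since \<open>{..<n}\<close> would miss position
    \<open>n\<close>.\<close>
  let ?s = "\<lambda>i. if n = i then u else \<zero>\<^bsub>M\<^esub>"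
  have "(\<Oplus>\<^bsub>M\<^esub>i\<in>{..<Suc n}. ?s i) = u"
    using u submoduleD(1)[OF S]
    by (intro M.finsum_singleton[of n "{..<Suc n}" "\<lambda>_. u"]) auto
  moreover have "\<forall>i<Suc n. ?s i \<in> S i"
    using u submoduleD(2)[OF S] by auto
  ultimately show "u \<in> submodule_sum M S"
    unfolding submodule_sum_def by (intro CollectI exI[of _ "Suc n"] exI[of _ ?s]) simp
qed

lemma submodule_sum_subset:
  assumes "submodule N R M" "\<And>n. S n \<subseteq> N"
  shows "submodule_sum M S \<subseteq> N"
  unfolding submodule_sum_def using assms(2) by (auto intro!: finsum_mem_submodule[OF assms(1)])

end

section \<open>Products of submodules and iterated right multiplication, from bilinearity
  alone\<close>

context nonassoc_algebra
begin

text \<open>The zero vector is the scalar 0 times itself, and that scalar moves out of the product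
  by bilinearity.\<close>

lemma mult_zero_left:
  assumes "y \<in> carrier A" shows "\<zero>\<^bsub>A\<^esub> \<otimes>\<^bsub>A\<^esub> y = \<zero>\<^bsub>A\<^esub>"
  using mult_smult_left[of \<zero> "\<zero>\<^bsub>A\<^esub>" y] assms mult_closed by simp

lemma mult_zero_right:
  assumes "x \<in> carrier A" shows "x \<otimes>\<^bsub>A\<^esub> \<zero>\<^bsub>A\<^esub> = \<zero>\<^bsub>A\<^esub>"
  using mult_smult_right[of \<zero> x "\<zero>\<^bsub>A\<^esub>"] assms mult_closed by simp

text \<open>Multiplication by a fixed \<open>a\<close> is linear, so the preimage of
  \<open>N\<close> is a submodule. To show that \<open>a\<close> multiplies a product or a sum of
  submodules into \<open>N\<close>, it then suffices to check single products or single summands;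
  this replaces repeated inductions over finite sums.\<close>

lemma submodule_left_preimage:
  assumes N: "submodule N k A" and a: "a \<in> carrier A"
  shows "submodule {u \<in> carrier A. a \<otimes>\<^bsub>A\<^esub> u \<in> N} k A"
  using submoduleD[OF N] a
  by (intro submodule_by_closure) (auto simp: mult_zero_right mult_add_right mult_smult_right)

lemma submodule_right_preimage:
  assumes N: "submodule N k A" and a: "a \<in> carrier A"
  shows "submodule {u \<in> carrier A. u \<otimes>\<^bsub>A\<^esub> a \<in> N} k A"
  using submoduleD[OF N] a
  by (intro submodule_by_closure) (auto simp: mult_zero_left mult_add_left mult_smult_left)

text \<open>One more product is appended to a finite sum. Closure of \<open>submodule_prod\<close>
  under addition follows by iterating this, without concatenating two index ranges.\<close>

lemma submodule_prod_add_product: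
  assumes X: "X \<subseteq> carrier A" and Y: "Y \<subseteq> carrier A"
    and u: "u \<in> submodule_prod A X Y" and x: "x \<in> X" and y: "y \<in> Y"
  shows "u \<oplus>\<^bsub>A\<^esub> x \<otimes>\<^bsub>A\<^esub> y \<in> submodule_prod A X Y"
proof -
  obtain n :: nat and f g where u: "u = (\<Oplus>\<^bsub>A\<^esub>i\<in>{..<n}. f i \<otimes>\<^bsub>A\<^esub> g i)"
    and fg: "\<forall>i<n. f i \<in> X" "\<forall>i<n. g i \<in> Y"
    using u unfolding submodule_prod_def by blast
  \<comment> \<open>Index \<open>n\<close> lies just beyond the range of the old sum, so the updates
    leave the old terms alone.\<close>
  let ?f = "f(n := x)" and ?g = "g(n := y)"
  have c: "f i \<otimes>\<^bsub>A\<^esub> g i \<in> carrier A" if "i < n" for i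
    using that fg X Y mult_closed by blast
  have xy: "x \<otimes>\<^bsub>A\<^esub> y \<in> carrier A"
    using x y X Y mult_closed by blast
  have "(\<Oplus>\<^bsub>A\<^esub>i\<in>{..<n}. ?f i \<otimes>\<^bsub>A\<^esub> ?g i) = u"
    unfolding u using c by (intro M.finsum_cong') auto
  then have "(\<Oplus>\<^bsub>A\<^esub>i\<in>{..<Suc n}. ?f i \<otimes>\<^bsub>A\<^esub> ?g i) = x \<otimes>\<^bsub>A\<^esub> y \<oplus>\<^bsub>A\<^esub> u"
    using c xy by (simp add: lessThan_Suc Pi_def)
  moreover have "u \<in> carrier A"
    unfolding u using c by (intro M.finsum_closed) auto
  ultimately have "u \<oplus>\<^bsub>A\<^esub> x \<otimes>\<^bsub>A\<^esub> y = (\<Oplus>\<^bsub>A\<^esub>i\<in>{..<Suc n}. ?f i \<otimes>\<^bsub>A\<^esub> ?g i)"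
    using xy by (simp add: M.a_comm)
  moreover have "\<forall>i<Suc n. ?f i \<in> X" "\<forall>i<Suc n. ?g i \<in> Y"
    using fg x y by auto
  ultimately show ?thesis
    unfolding submodule_prod_def by blast
qed

lemma zero_mem_submodule_prod: "\<zero>\<^bsub>A\<^esub> \<in> submodule_prod A X Y"
  unfolding submodule_prod_def by (force intro: exI[of _ 0])

lemma product_mem_submodule_prod:
  assumes "X \<subseteq> carrier A" "Y \<subseteq> carrier A" "x \<in> X" "y \<in> Y"
  shows "x \<otimes>\<^bsub>A\<^esub> y \<in> submodule_prod A X Y"
  using submodule_prod_add_product[OF assms(1,2) zero_mem_submodule_prod assms(3,4)] assms mult_closed
  by (metis M.l_zero subsetD)

lemma submodule_prod_subset:
  assumes "submodule N k A" "\<And>x y. \<lbrakk>x \<in> X; y \<in> Y\<rbrakk> \<Longrightarrow> x \<otimes>\<^bsub>A\<^esub> y \<in> N"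
  shows "submodule_prod A X Y \<subseteq> N"
  unfolding submodule_prod_def using assms(2) by (auto intro!: finsum_mem_submodule[OF assms(1)])

text \<open>Sums are handled by appending products one at a time; scalars are absorbed into the left
  factor, where the closure of \<open>X\<close> applies.\<close>

lemma submodule_submodule_prod:
  assumes X: "submodule X k A" and Y: "Y \<subseteq> carrier A"
  shows "submodule (submodule_prod A X Y) k A"
proof (rule submodule_by_closure)
  note Xc = submoduleD(1)[OF X]
  have c: "x \<otimes>\<^bsub>A\<^esub> y \<in> carrier A" if "x \<in> X" "y \<in> Y" for x y
    using that Xc Y mult_closed by blast
  show Pc: "submodule_prod A X Y \<subseteq> carrier A"
    using c by (auto simp: submodule_prod_def intro!: M.finsum_closed)
  show "\<zero>\<^bsub>A\<^esub> \<in> submodule_prod A X Y"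
    by (rule zero_mem_submodule_prod)
  fix u v assume u: "u \<in> submodule_prod A X Y" and "v \<in> submodule_prod A X Y"
  then obtain n :: nat and f g where v: "v = (\<Oplus>\<^bsub>A\<^esub>i\<in>{..<n}. f i \<otimes>\<^bsub>A\<^esub> g i)"
    and "\<forall>i<n. f i \<in> X" "\<forall>i<n. g i \<in> Y"
    unfolding submodule_prod_def by blast
  \<comment> \<open>Induction on the number of products in \<open>v\<close>, with \<open>u\<close>
    kept fixed.\<close>
  from this(2,3) have "u \<oplus>\<^bsub>A\<^esub> (\<Oplus>\<^bsub>A\<^esub>i\<in>{..<n}. f i \<otimes>\<^bsub>A\<^esub> g i) \<in> submodule_prod A X Y"
  proof (induction n)
    case 0
    then show ?case using u Pc by auto
  next
    case (Suc n)
    let ?s = "\<Oplus>\<^bsub>A\<^esub>i\<in>{..<n}. f i \<otimes>\<^bsub>A\<^esub> g i"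
    have d: "f i \<otimes>\<^bsub>A\<^esub> g i \<in> carrier A" if "i < Suc n" for i
      using that c Suc.prems by simp
    then have s: "?s \<in> carrier A"
      by (intro M.finsum_closed) auto
    have "u \<oplus>\<^bsub>A\<^esub> (\<Oplus>\<^bsub>A\<^esub>i\<in>{..<Suc n}. f i \<otimes>\<^bsub>A\<^esub> g i) = (u \<oplus>\<^bsub>A\<^esub> ?s) \<oplus>\<^bsub>A\<^esub> f n \<otimes>\<^bsub>A\<^esub> g n"
      using d s u Pc by (simp add: lessThan_Suc Pi_def M.a_ac subset_iff)
    then show ?case
      using Suc submodule_prod_add_product[OF Xc Y] by simp
  qed
  then show "u \<oplus>\<^bsub>A\<^esub> v \<in> submodule_prod A X Y"
    using v by simp
next
  note Xc = submoduleD(1)[OF X]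
  fix r u assume r: "r \<in> carrier k" and "u \<in> submodule_prod A X Y"
  then obtain n :: nat and f g where u: "u = (\<Oplus>\<^bsub>A\<^esub>i\<in>{..<n}. f i \<otimes>\<^bsub>A\<^esub> g i)"
    and fg: "\<forall>i<n. f i \<in> X" "\<forall>i<n. g i \<in> Y"
    unfolding submodule_prod_def by blast
  have c: "f i \<in> carrier A" "g i \<in> carrier A" if "i < n" for i
    using that fg Xc Y by auto
  have "r \<odot>\<^bsub>A\<^esub> u = (\<Oplus>\<^bsub>A\<^esub>i\<in>{..<n}. r \<odot>\<^bsub>A\<^esub> (f i \<otimes>\<^bsub>A\<^esub> g i))"
    unfolding u using r c mult_closed by (intro finsum_smult_ldistr) auto
  also have "\<dots> = (\<Oplus>\<^bsub>A\<^esub>i\<in>{..<n}. (r \<odot>\<^bsub>A\<^esub> f i) \<otimes>\<^bsub>A\<^esub> g i)"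
    using r c mult_closed by (intro M.finsum_cong') (auto simp: mult_smult_left)
  finally show "r \<odot>\<^bsub>A\<^esub> u \<in> submodule_prod A X Y"
    using fg submoduleD(5)[OF X r] unfolding submodule_prod_def
    by (intro CollectI exI[of _ n] exI[of _ "\<lambda>i. r \<odot>\<^bsub>A\<^esub> f i"] exI[of _ g]) auto
qed

lemma submodule_right_mult_iter:
  assumes "submodule X k A"
  shows "submodule (right_mult_iter A X n) k A"
  by (induction n) (use assms submodule_submodule_prod in auto)

lemma right_mult_iter_mult:
  assumes "submodule X k A" "s \<in> right_mult_iter A X n" "a \<in> carrier A"
  shows "s \<otimes>\<^bsub>A\<^esub> a \<in> right_mult_iter A X (Suc n)"
  using product_mem_submodule_prod[OF submoduleD(1)[OF submodule_right_mult_iter[OF assms(1)]]] assms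
  by simp

text \<open>Right multiplication by \<open>a\<close> shifts each
  \<open>right_mult_iter A X n\<close> into the next one, so it cannot leave the sum of all of
  them.\<close>

lemma right_mult_submodule_sum:
  assumes X: "submodule X k A" and a: "a \<in> carrier A"
    and u: "u \<in> submodule_sum A (right_mult_iter A X)"
  shows "u \<otimes>\<^bsub>A\<^esub> a \<in> submodule_sum A (right_mult_iter A X)"
proof -
  note S = submodule_right_mult_iter[OF X]
  note T = submodule_submodule_sum[of "right_mult_iter A X", OF S]
  have "submodule_sum A (right_mult_iter A X)
      \<subseteq> {u \<in> carrier A. u \<otimes>\<^bsub>A\<^esub> a \<in> submodule_sum A (right_mult_iter A X)}"
  proof (rule submodule_sum_subset[OF submodule_right_preimage[OF T a]], rule subsetI)
    fix n s assume s: "s \<in> right_mult_iter A X n"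
    then show "s \<in> {u \<in> carrier A. u \<otimes>\<^bsub>A\<^esub> a \<in> submodule_sum A (right_mult_iter A X)}"
      using submoduleD(1)[OF S] right_mult_iter_mult[OF X s a]
        submodule_sum_superset[of "right_mult_iter A X", OF S] by blast
  qed
  then show ?thesis using u by blast
qed

end

section \<open>Consequences of the pre-Lie identity for ideals\<close>

context pre_lie_algebra
begin

text \<open>By the pre-Lie identity the inner difference equals \<open>(xy)z - x(yz)\<close>, so the
  right-hand side has the form \<open>u - (u - v)\<close>. Membership of \<open>x(yz)\<close> in a
  submodule thus reduces to that of three other products.\<close>

lemma mult_mult_eq:
  assumes "x \<in> carrier A" "y \<in> carrier A" "z \<in> carrier A"
  shows "x \<otimes>\<^bsub>A\<^esub> (y \<otimes>\<^bsub>A\<^esub> z) =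
    (x \<otimes>\<^bsub>A\<^esub> y) \<otimes>\<^bsub>A\<^esub> z \<ominus>\<^bsub>A\<^esub> ((y \<otimes>\<^bsub>A\<^esub> x) \<otimes>\<^bsub>A\<^esub> z \<ominus>\<^bsub>A\<^esub> y \<otimes>\<^bsub>A\<^esub> (x \<otimes>\<^bsub>A\<^esub> z))"
  unfolding pre_lie[OF assms, symmetric] using assms
  by (simp add: M.minus_minus_cancel mult_closed)

text \<open>Here the replaced difference gives the form \<open>(u - v) + v\<close>. The identity
  trades \<open>(xy)z\<close> for products in which \<open>x\<close> and \<open>y\<close> are
  swapped, plus \<open>x(yz)\<close>.\<close>

lemma mult_assoc_eq:
  assumes "x \<in> carrier A" "y \<in> carrier A" "z \<in> carrier A"
  shows "(x \<otimes>\<^bsub>A\<^esub> y) \<otimes>\<^bsub>A\<^esub> z =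
    ((y \<otimes>\<^bsub>A\<^esub> x) \<otimes>\<^bsub>A\<^esub> z \<ominus>\<^bsub>A\<^esub> y \<otimes>\<^bsub>A\<^esub> (x \<otimes>\<^bsub>A\<^esub> z)) \<oplus>\<^bsub>A\<^esub> x \<otimes>\<^bsub>A\<^esub> (y \<otimes>\<^bsub>A\<^esub> z)"
  unfolding pre_lie[OF assms, symmetric] using assms
  by (simp add: M.minus_add_cancel mult_closed)

text \<open>In \<open>a(ij) = (ai)j - ((ia)j - i(aj))\<close> each term on the right is a product of
  an element of \<open>I\<close> and one of \<open>J\<close>.\<close>

lemma left_mult_ideal_prod:
  assumes I: "algebra_ideal I k A" and J: "algebra_ideal J k A"
    and a: "a \<in> carrier A" and u: "u \<in> submodule_prod A I J"
  shows "a \<otimes>\<^bsub>A\<^esub> u \<in> submodule_prod A I J"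
proof -
  have sub: "submodule I k A" "submodule J k A"
    using I J by (auto simp: algebra_ideal_def)
  note c = this[THEN submoduleD(1)]
  have P: "submodule (submodule_prod A I J) k A"
    using submodule_submodule_prod sub(1) c(2) by blast
  have "submodule_prod A I J \<subseteq> {u \<in> carrier A. a \<otimes>\<^bsub>A\<^esub> u \<in> submodule_prod A I J}"
  proof (rule submodule_prod_subset[OF submodule_left_preimage[OF P a]])
    fix i j assume ij: "i \<in> I" "j \<in> J"
    then have ij_c: "i \<in> carrier A" "j \<in> carrier A"
      using c by auto
    have "a \<otimes>\<^bsub>A\<^esub> i \<in> I" "i \<otimes>\<^bsub>A\<^esub> a \<in> I" "a \<otimes>\<^bsub>A\<^esub> j \<in> J"
      using I J a ij by (auto simp: algebra_ideal_def)
    then have "a \<otimes>\<^bsub>A\<^esub> (i \<otimes>\<^bsub>A\<^esub> j) \<in> submodule_prod A I J"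
      unfolding mult_mult_eq[OF a ij_c] using ij
      by (intro submoduleD(4)[OF P] product_mem_submodule_prod[OF c])
    then show "i \<otimes>\<^bsub>A\<^esub> j \<in> {u \<in> carrier A. a \<otimes>\<^bsub>A\<^esub> u \<in> submodule_prod A I J}"
      using ij_c mult_closed by simp
  qed
  then show ?thesis using u by blast
qed

text \<open>Induction on \<open>n\<close> through \<open>a(sb) = (as)b - ((sa)b - s(ab))\<close>.
  The terms on the right land at different levels, which is why the conclusion names the whole sum.
  The hypothesis \<open>left\<close> is the base case; it is later supplied for
  \<open>X = JI\<close>.\<close>

lemma left_mult_right_mult_iter:
  assumes X: "submodule X k A" and left: "\<And>a x. \<lbrakk>a \<in> carrier A; x \<in> X\<rbrakk> \<Longrightarrow> a \<otimes>\<^bsub>A\<^esub> x \<in> X"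
    and a: "a \<in> carrier A" and s: "s \<in> right_mult_iter A X n"
  shows "a \<otimes>\<^bsub>A\<^esub> s \<in> submodule_sum A (right_mult_iter A X)"
proof -
  let ?T = "submodule_sum A (right_mult_iter A X)"
  note S = submodule_right_mult_iter[OF X]
  note T = submodule_submodule_sum[of "right_mult_iter A X", OF S]
  note sup = submodule_sum_superset[of "right_mult_iter A X", OF S, THEN subsetD]
  show ?thesis using s
  proof (induction n arbitrary: s)
    case 0
    then show ?case using sup[of _ 0] left a by simp
  next
    case (Suc n)
    have "submodule_prod A (right_mult_iter A X n) (carrier A) \<subseteq> {u \<in> carrier A. a \<otimes>\<^bsub>A\<^esub> u \<in> ?T}"
    proof (rule submodule_prod_subset[OF submodule_left_preimage[OF T a]])
      fix s b assume s: "s \<in> right_mult_iter A X n" and b: "b \<in> carrier A"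
      then have sc: "s \<in> carrier A" using submoduleD(1)[OF S] by blast
      \<comment> \<open>The induction hypothesis only places \<open>as\<close> somewhere in
        \<open>?T\<close>, so stability of all of \<open>?T\<close> under right multiplication is
        used.\<close>
      have "(a \<otimes>\<^bsub>A\<^esub> s) \<otimes>\<^bsub>A\<^esub> b \<in> ?T"
        using right_mult_submodule_sum[OF X b Suc.IH[OF s]] .
      \<comment> \<open>Two right multiplications lead from level \<open>n\<close> to level
        \<open>n + 2\<close>; the next term, \<open>s(ab)\<close>, is at level
        \<open>n + 1\<close>.\<close>
      moreover have "(s \<otimes>\<^bsub>A\<^esub> a) \<otimes>\<^bsub>A\<^esub> b \<in> ?T"
        using sup right_mult_iter_mult[OF X] s a b by blast
      moreover have "s \<otimes>\<^bsub>A\<^esub> (a \<otimes>\<^bsub>A\<^esub> b) \<in> ?T"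
        using sup right_mult_iter_mult[OF X s] mult_closed a b by blast
      ultimately have "a \<otimes>\<^bsub>A\<^esub> (s \<otimes>\<^bsub>A\<^esub> b) \<in> ?T"
        unfolding mult_mult_eq[OF a sc b] by (intro submoduleD(4)[OF T])
      then show "s \<otimes>\<^bsub>A\<^esub> b \<in> {u \<in> carrier A. a \<otimes>\<^bsub>A\<^esub> u \<in> ?T}"
        using sc b mult_closed by simp
    qed
    then show ?case using Suc.prems by auto
  qed
qed

lemma left_mult_submodule_sum:
  assumes X: "submodule X k A" and left: "\<And>a x. \<lbrakk>a \<in> carrier A; x \<in> X\<rbrakk> \<Longrightarrow> a \<otimes>\<^bsub>A\<^esub> x \<in> X"
    and a: "a \<in> carrier A" and u: "u \<in> submodule_sum A (right_mult_iter A X)"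
  shows "a \<otimes>\<^bsub>A\<^esub> u \<in> submodule_sum A (right_mult_iter A X)"
proof -
  note S = submodule_right_mult_iter[OF X]
  note T = submodule_submodule_sum[of "right_mult_iter A X", OF S]
  have "submodule_sum A (right_mult_iter A X)
      \<subseteq> {u \<in> carrier A. a \<otimes>\<^bsub>A\<^esub> u \<in> submodule_sum A (right_mult_iter A X)}"
    using submoduleD(1)[OF S] left_mult_right_mult_iter[OF X left a]
    by (intro submodule_sum_subset[OF submodule_left_preimage[OF T a]]) blast
  then show ?thesis using u by blast
qed

text \<open>This is where the two summands interact: in
  \<open>(ij)a = ((ji)a - j(ia)) + i(ja)\<close> the swapped terms lie at levels 1 and 0 of the
  iteration starting from \<open>JI\<close>, and the last term lies in \<open>IJ\<close>.\<close>

lemma right_mult_ideal_prod: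
  assumes I: "algebra_ideal I k A" and J: "algebra_ideal J k A"
    and a: "a \<in> carrier A" and u: "u \<in> submodule_prod A I J"
  shows "u \<otimes>\<^bsub>A\<^esub> a \<in>
    submodule_prod A I J <+>\<^bsub>A\<^esub> submodule_sum A (right_mult_iter A (submodule_prod A J I))"
    (is "_ \<in> ?P <+>\<^bsub>A\<^esub> ?T")
proof -
  have sub: "submodule I k A" "submodule J k A"
    using I J by (auto simp: algebra_ideal_def)
  note c = this[THEN submoduleD(1)]
  have P: "submodule ?P k A" and X: "submodule (submodule_prod A J I) k A"
    using submodule_submodule_prod sub c by blast+
  note S = submodule_right_mult_iter[OF X]
  have T: "submodule ?T k A"
    using submodule_submodule_sum[of "right_mult_iter A (submodule_prod A J I)", OF S] .
  have sup: "v \<in> ?T" if "v \<in> right_mult_iter A (submodule_prod A J I) n" for v n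
    using submodule_sum_superset[of "right_mult_iter A (submodule_prod A J I)", OF S] that by blast
  have PT: "submodule (?P <+>\<^bsub>A\<^esub> ?T) k A"
    using set_add_submodule[OF P T] .
  have "?P \<subseteq> {u \<in> carrier A. u \<otimes>\<^bsub>A\<^esub> a \<in> ?P <+>\<^bsub>A\<^esub> ?T}"
  proof (rule submodule_prod_subset[OF submodule_right_preimage[OF PT a]])
    fix i j assume ij: "i \<in> I" "j \<in> J"
    then have ij_c: "i \<in> carrier A" "j \<in> carrier A"
      using c by auto
    have ia: "i \<otimes>\<^bsub>A\<^esub> a \<in> I" and ja: "j \<otimes>\<^bsub>A\<^esub> a \<in> J"
      using I J a ij by (auto simp: algebra_ideal_def)
    \<comment> \<open>Stated at level 0 of the iteration, so that one right multiplication visibly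
      gives level 1.\<close>
    have ji: "v \<otimes>\<^bsub>A\<^esub> w \<in> right_mult_iter A (submodule_prod A J I) 0" if "v \<in> J" "w \<in> I" for v w
      using product_mem_submodule_prod[OF c(2,1) that] by simp
    have "(j \<otimes>\<^bsub>A\<^esub> i) \<otimes>\<^bsub>A\<^esub> a \<in> ?T"
      using sup right_mult_iter_mult[OF X ji[OF ij(2,1)] a] by blast
    moreover have "j \<otimes>\<^bsub>A\<^esub> (i \<otimes>\<^bsub>A\<^esub> a) \<in> ?T"
      using sup[OF ji[OF ij(2) ia]] .
    moreover have "i \<otimes>\<^bsub>A\<^esub> (j \<otimes>\<^bsub>A\<^esub> a) \<in> ?P"
      using product_mem_submodule_prod[OF c ij(1) ja] .
    ultimately have "(i \<otimes>\<^bsub>A\<^esub> j) \<otimes>\<^bsub>A\<^esub> a \<in> ?P <+>\<^bsub>A\<^esub> ?T"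
      unfolding mult_assoc_eq[OF ij_c a]
      using submoduleD(3)[OF PT] submoduleD(4)[OF PT] set_add_superset[OF P T] by blast
    then show "i \<otimes>\<^bsub>A\<^esub> j \<in> {u \<in> carrier A. u \<otimes>\<^bsub>A\<^esub> a \<in> ?P <+>\<^bsub>A\<^esub> ?T}"
      using ij_c mult_closed by simp
  qed
  then show ?thesis using u by blast
qed

lemma algebra_ideal_commutator_formula:
  assumes I: "algebra_ideal I k A" and J: "algebra_ideal J k A"
  shows "algebra_ideal
    (submodule_prod A I J <+>\<^bsub>A\<^esub> submodule_sum A (right_mult_iter A (submodule_prod A J I))) k A"
    (is "algebra_ideal (?P <+>\<^bsub>A\<^esub> ?T) k A")
proof -
  have sub: "submodule I k A" "submodule J k A"
    using I J by (auto simp: algebra_ideal_def)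
  note c = this[THEN submoduleD(1)]
  have P: "submodule ?P k A" and X: "submodule (submodule_prod A J I) k A"
    using submodule_submodule_prod sub c by blast+
  have T: "submodule ?T k A"
    using submodule_submodule_sum[of "right_mult_iter A (submodule_prod A J I)",
        OF submodule_right_mult_iter[OF X]] .
  have PT: "submodule (?P <+>\<^bsub>A\<^esub> ?T) k A"
    using set_add_submodule[OF P T] .
  note sup = set_add_superset[OF P T, THEN subsetD]
  \<comment> \<open>As the preimage is a submodule, it is enough that it contains \<open>?P\<close>
    and \<open>?T\<close> separately. For \<open>?T\<close>, the required left stability of
    \<open>JI\<close> is \<open>left_mult_ideal_prod\<close> with the two ideals exchanged.\<close>
  have "?P <+>\<^bsub>A\<^esub> ?T \<subseteq> {u \<in> carrier A. a \<otimes>\<^bsub>A\<^esub> u \<in> ?P <+>\<^bsub>A\<^esub> ?T}" if a: "a \<in> carrier A" for a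
    using submoduleD(1)[OF P] submoduleD(1)[OF T] sup(1)[OF left_mult_ideal_prod[OF I J a]]
      sup(2)[OF left_mult_submodule_sum[OF X left_mult_ideal_prod[OF J I] a]]
    by (intro set_add_subset[OF submodule_left_preimage[OF PT a]]) blast+
  moreover
  have "?P <+>\<^bsub>A\<^esub> ?T \<subseteq> {u \<in> carrier A. u \<otimes>\<^bsub>A\<^esub> a \<in> ?P <+>\<^bsub>A\<^esub> ?T}" if a: "a \<in> carrier A" for a
    using submoduleD(1)[OF P] submoduleD(1)[OF T] right_mult_ideal_prod[OF I J a]
      sup(2)[OF right_mult_submodule_sum[OF X a]]
    by (intro set_add_subset[OF submodule_right_preimage[OF PT a]]) blast+
  ultimately show ?thesis
    using PT unfolding algebra_ideal_def by blast
qed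

end

theorem proposition12:
  fixes k :: "('k, 'r) ring_scheme" and A :: "('k, 'a, 'm) module_scheme" and I J :: "'a set"
  assumes "pre_lie_algebra k A"
    and "algebra_ideal I k A"
    and "algebra_ideal J k A"
  shows "ideal_commutator k A I J =
    submodule_prod A I J <+>\<^bsub>A\<^esub>
    submodule_sum A (\<lambda>n. right_mult_iter A (submodule_prod A J I) n)"
proof -
  interpret pre_lie_algebra k A by fact
  let ?P = "submodule_prod A I J" and ?S = "right_mult_iter A (submodule_prod A J I)"
  let ?T = "submodule_sum A ?S"
  let ?G = "{i \<otimes>\<^bsub>A\<^esub> j | i j. i \<in> I \<and> j \<in> J} \<union> {j \<otimes>\<^bsub>A\<^esub> i | i j. i \<in> I \<and> j \<in> J}"
  have sub: "submodule I k A" "submodule J k A"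
    using assms(2,3) by (auto simp: algebra_ideal_def)
  note c = this[THEN submoduleD(1)]
  have P: "submodule ?P k A" and X: "submodule (submodule_prod A J I) k A"
    using submodule_submodule_prod sub c by blast+
  note S = submodule_right_mult_iter[OF X]
  have T: "submodule ?T k A"
    using submodule_submodule_sum[of ?S, OF S] .
  \<comment> \<open>The generators \<open>ij\<close> lie in \<open>?P\<close>, and the generators
    \<open>ji\<close> lie in the term of index 0 of \<open>?T\<close>.\<close>
  have "submodule_prod A J I \<subseteq> ?T"
    using submodule_sum_superset[of ?S 0, OF S] by simp
  then have "?G \<subseteq> ?P <+>\<^bsub>A\<^esub> ?T"
    using set_add_superset[OF P T] product_mem_submodule_prod[OF c]
      product_mem_submodule_prod[OF c(2,1)] by blast
  then have "ideal_commutator k A I J \<subseteq> ?P <+>\<^bsub>A\<^esub> ?T"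
    unfolding ideal_commutator_def generated_algebra_ideal_def
    using algebra_ideal_commutator_formula[OF assms(2,3)] by (intro Inter_lower) simp
  \<comment> \<open>For the converse inclusion, the formula is shown to lie in every ideal
    \<open>N\<close> of the family whose intersection is the commutator.\<close>
  moreover have "?P <+>\<^bsub>A\<^esub> ?T \<subseteq> N" if N: "algebra_ideal N k A" and G: "?G \<subseteq> N" for N
  proof (rule set_add_subset)
    show sN: "submodule N k A" using N by (simp add: algebra_ideal_def)
    show "?P \<subseteq> N" using G by (intro submodule_prod_subset[OF sN]) blast
    \<comment> \<open>The products \<open>ji\<close> start the induction; absorption of right
      factors by the ideal \<open>N\<close> carries it on.\<close>
    have "?S n \<subseteq> N" for n
    proof (induction n)
      case 0
      have "submodule_prod A J I \<subseteq> N"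
        using G by (intro submodule_prod_subset[OF sN]) blast
      then show ?case by simp
    next
      case (Suc n)
      have "submodule_prod A (?S n) (carrier A) \<subseteq> N"
        using N Suc by (intro submodule_prod_subset[OF sN]) (auto simp: algebra_ideal_def)
      then show ?case by simp
    qed
    then show "?T \<subseteq> N" by (rule submodule_sum_subset[OF sN])
  qed
  then have "?P <+>\<^bsub>A\<^esub> ?T \<subseteq> ideal_commutator k A I J"
    unfolding ideal_commutator_def generated_algebra_ideal_def by (intro Inter_greatest) simp
  ultimately show ?thesis by (rule subset_antisym)
qed

end
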